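(* Let $p,q\ge1$ and let $\mathbf{X}=(\mathbf{X}_1^\top,\mathbf{X}_2^\top)^\top\sim EC_{q+p}(\boldsymbol{\xi},\boldsymbol{\Omega},h^{(q+p)})$ with $\mathbf{X}_1\in\mathbb{R}^q$, $\mathbf{X}_2\in\mathbb{R}^p$. Let $C(\mathbf{c},\mathbf{d})=\{\mathbf{x}_1\in\mathbb{R}^q:\mathbf{c}\le\mathbf{x}_1\le\mathbf{d}\}$ and $\mathbf{Y}\sim SLCT\text{-}EC_{p,q}(\boldsymbol{\xi},\boldsymbol{\Omega},h^{(q+p)},C(\mathbf{c},\mathbf{d}))$, i.e. $\mathbf{Y}\overset{d}{=}(\mathbf{X}_2\mid\mathbf{X}_1\in C(\mathbf{c},\mathbf{d}))$. Let $\mathbf{a},\mathbf{b}$ be $p$-dimensional truncation limits (entries possibly infinite), $\boldsymbol{\alpha}=(\mathbf{c}^\top,\mathbf{a}^\top)^\top$, $\boldsymbol{\beta}=(\mathbf{d}^\top,\mathbf{b}^\top)^\top$, and let $\mathbf{m}=\mathbb{E}[\mathbf{X}\mid\boldsymbol{\alpha}\le\mathbf{X}\le\boldsymbol{\beta}]$ and $\mathbf{M}=\mathbb{E}[\mathbf{X}\mathbf{X}^\top\mid\boldsymbol{\alpha}\le\mathbf{X}\le\boldsymbol{\beta}]$ be partitioned as $$\mathbf{m}=\begin{pmatrix}\mathbf{m}_1\\ \mathbf{m}_2\end{pmatrix},\qquad \mathbf{M}=\begin{pmatrix}\mathbf{M}_{11}&\mathbf{M}_{12}\\ \mathbf{M}_{21}&\mathbf{M}_{22}\end{pmatrix},$$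 with $\mathbf{m}_2\in\mathbb{R}^p$ and $\mathbf{M}_{22}\in\mathbb{R}^{p\times p}$. Then $$\mathbb{E}[\mathbf{Y}\mid\mathbf{a}\le\mathbf{Y}\le\mathbf{b}]=\mathbf{m}_2,\qquad \mathbb{E}[\mathbf{Y}\mathbf{Y}^\top\mid\mathbf{a}\le\mathbf{Y}\le\mathbf{b}]=\mathbf{M}_{22}.$$
   Context: Elliptical distribution: $\mathbf{X}\sim EC_{r}(\boldsymbol{\xi},\boldsymbol{\Omega},h^{(r)})$ means that $\mathbf{X}$ has density $|\boldsymbol{\Omega}|^{-1/2}h^{(r)}\big((\mathbf{x}-\boldsymbol{\xi})^\top\boldsymbol{\Omega}^{-1}(\mathbf{x}-\boldsymbol{\xi})\big)$ on $\mathbb{R}^r$, with location $\boldsymbol{\xi}$, positive-definite dispersion matrix $\boldsymbol{\Omega}$ and density generator $h^{(r)}$. Selection distribution: for measurable $C\subseteq\mathbb{R}^q$ with $\mathbb{P}(\mathbf{X}_1\in C)>0$, $SLCT\text{-}EC_{p,q}(\boldsymbol{\xi},\boldsymbol{\Omega},h^{(q+p)},C)$ is the conditional law of $\mathbf{X}_2$ given $\mathbf{X}_1\in C$. Vector inequalities are componentwise. Conditioning events are assumed to have positive probability, and the moments $\mathbf{m}$, $\mathbf{M}$ are assumed to exist. *)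

theory Defs
  imports "HOL-Probability.Probability"
begin

text \<open>
  Vectors of dimension \<open>q + p\<close> are indexed by the sum type \<open>'q + 'p\<close>; the \<open>Inl\<close> indices
  carry the first block and the \<open>Inr\<close> indices the second.
\<close>

definition vstack :: "'e ^ 'q \<Rightarrow> 'e ^ 'p \<Rightarrow> 'e ^ (('q::finite) + ('p::finite))" where
  "vstack u v = (\<chi> k. case k of Inl i \<Rightarrow> u $ i | Inr j \<Rightarrow> v $ j)"

definition vfst :: "'e ^ (('q::finite) + ('p::finite)) \<Rightarrow> 'e ^ 'q" where
  "vfst x = (\<chi> i. x $ Inl i)"

definition vsnd :: "'e ^ (('q::finite) + ('p::finite)) \<Rightarrow> 'e ^ 'p" where
  "vsnd x = (\<chi> j. x $ Inr j)"

definition block_matrix ::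
    "'e ^ 'q ^ 'q \<Rightarrow> 'e ^ 'p ^ 'q \<Rightarrow> 'e ^ 'q ^ 'p \<Rightarrow> 'e ^ 'p ^ 'p
      \<Rightarrow> 'e ^ (('q::finite) + ('p::finite)) ^ ('q + 'p)" where
  "block_matrix A B C D =
     (\<chi> k. case k of Inl i \<Rightarrow> vstack (A $ i) (B $ i) | Inr j \<Rightarrow> vstack (C $ j) (D $ j))"

text \<open>The matrix \<open>x x\<^sup>T\<close>.\<close>

definition outer :: "real ^ 'n \<Rightarrow> real ^ 'n ^ 'n" where
  "outer x = (\<chi> i j. x $ i * x $ j)"

text \<open>Truncation limits are extended reals, so that entries may be infinite.\<close>

definition trunc_box :: "ereal ^ 'n \<Rightarrow> ereal ^ 'n \<Rightarrow> (real ^ 'n) set" where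
  "trunc_box a b = {x. \<forall>i. a $ i \<le> ereal (x $ i) \<and> ereal (x $ i) \<le> b $ i}"

definition pos_def_matrix :: "real ^ 'n ^ 'n \<Rightarrow> bool" where
  "pos_def_matrix A \<longleftrightarrow> transpose A = A \<and> (\<forall>x. x \<noteq> 0 \<longrightarrow> x \<bullet> (A *v x) > 0)"

definition EC_density :: "real ^ 'n \<Rightarrow> real ^ 'n ^ 'n \<Rightarrow> (real \<Rightarrow> real) \<Rightarrow> real ^ 'n \<Rightarrow> real" where
  "EC_density \<xi> \<Omega> h x = det \<Omega> powr (- 1 / 2) * h ((x - \<xi>) \<bullet> (matrix_inv \<Omega> *v (x - \<xi>)))"

text \<open>
  The random vector \<open>X\<close> on \<open>S\<close> is \<open>EC(\<xi>, \<Omega>, h)\<close>. On a probability space the normalisation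
  of \<open>h\<close> and the measurability of the density follow from \<^const>\<open>distributed\<close>. Nonnegativity
  does not, because \<^const>\<open>ennreal\<close> truncates negative values, so it is required separately.
\<close>

definition elliptical ::
    "'s measure \<Rightarrow> ('s \<Rightarrow> real ^ 'n) \<Rightarrow> real ^ 'n \<Rightarrow> real ^ 'n ^ 'n \<Rightarrow> (real \<Rightarrow> real) \<Rightarrow> bool" where
  "elliptical S X \<xi> \<Omega> h \<longleftrightarrow>
     pos_def_matrix \<Omega> \<and> (\<forall>u\<ge>0. h u \<ge> 0) \<and>
     distributed S lborel X (\<lambda>x. ennreal (EC_density \<xi> \<Omega> h x))"

text \<open>
  The law \<open>SLCT-EC(\<xi>, \<Omega>, h, C)\<close>: the conditional law of the second block of an
  \<open>EC(\<xi>, \<Omega>, h)\<close> vector, given that its first block lies in \<open>C\<close>.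
\<close>

definition SLCT_EC ::
    "real ^ (('q::finite) + ('p::finite)) \<Rightarrow> real ^ ('q + 'p) ^ ('q + 'p) \<Rightarrow> (real \<Rightarrow> real) \<Rightarrow> (real ^ 'q) set
      \<Rightarrow> (real ^ 'p) measure" where
  "SLCT_EC \<xi> \<Omega> h C =
     distr
       (uniform_measure (density lborel (\<lambda>x. ennreal (EC_density \<xi> \<Omega> h x))) {x. vfst x \<in> C})
       borel vsnd"

text \<open>
  \<open>E[f | A] = v\<close> for an event \<open>A\<close> of positive probability, including the existence of the
  expectation: \<^term>\<open>uniform_measure S A\<close> is the conditional probability given \<open>A\<close>.
\<close>

definition has_cond_expectation ::
    "'s measure \<Rightarrow> ('s \<Rightarrow> 'b::{banach, second_countable_topology}) \<Rightarrow> 's set \<Rightarrow> 'b \<Rightarrow> bool" where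
  "has_cond_expectation S f A v \<longleftrightarrow> has_bochner_integral (uniform_measure S A) f v"

end

theory Submission
  imports Defs
begin

text \<open>Truncating \<open>Y\<close> to the box from \<open>a\<close> to \<open>b\<close> means
  conditioning the second block of \<open>X\<close> twice: on the first block lying in the box from
  \<open>c\<close> to \<open>d\<close>, then on the second block lying in its own box. Conditioning
  twice is conditioning once on the intersection (\<open>uniform_measure_uniform_measure\<close>),
  and by \<open>trunc_box_vstack\<close> that intersection is the event that \<open>X\<close> lies
  in the stacked box. Since conditioning commutes with taking image measures
  (\<open>uniform_measure_distr\<close>), the truncated \<open>Y\<close> has the law of the second
  block of the truncated \<open>X\<close>; this is \<open>SLCT_EC_truncated\<close>.

  Expectations depend only on the law, so it remains to compute those of the second block and of its
  outer product under the truncated law of \<open>X\<close>. Both arise from \<open>X\<close> and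
  \<open>outer (X \<omega>)\<close> by bounded linear maps, which commute with the Bochner integral
  and send \<open>m\<close> to \<open>m2\<close> and \<open>M\<close> to \<open>M22\<close>.\<close>

lemma uniform_measure_distr:
  assumes [measurable]: "f \<in> measurable M N" "A \<in> sets N"
  shows "uniform_measure (distr M N f) A = distr (uniform_measure M {x \<in> space M. f x \<in> A}) N f"
proof (rule measure_eqI)
  fix B assume "B \<in> sets (uniform_measure (distr M N f) A)"
  then have [measurable]: "B \<in> sets N"
    by simp
  have "f -` A \<inter> space M = {x \<in> space M. f x \<in> A}"
    and "f -` (A \<inter> B) \<inter> space M = {x \<in> space M. f x \<in> A} \<inter> (f -` B \<inter> space M)"
    by auto
  then show "emeasure (uniform_measure (distr M N f) A) B =
      emeasure (distr (uniform_measure M {x \<in> space M. f x \<in> A}) N f) B"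
    by (simp add: emeasure_distr)
qed simp

text \<open>The normalising factor of the first conditioning cancels in the second, provided that it
  is neither 0 nor infinite.\<close>

lemma uniform_measure_uniform_measure:
  assumes [measurable]: "A \<in> sets M" "B \<in> sets M"
    and "emeasure M A \<noteq> 0" "emeasure M A \<noteq> \<infinity>"
  shows "uniform_measure (uniform_measure M A) B = uniform_measure M (A \<inter> B)"
proof (rule measure_eqI)
  fix D assume "D \<in> sets (uniform_measure (uniform_measure M A) B)"
  then have [measurable]: "D \<in> sets M"
    by simp
  \<comment> \<open>Here \<open>a\<close> is the mass of \<open>A\<close> and \<open>y\<close> that
    of \<open>A \<inter> B\<close>. The case \<open>y = 0\<close> is covered: both sides are then 0
    if \<open>x = 0\<close> and infinite otherwise.\<close>
  have "x / a / (y / a) = x / y" if "a \<noteq> 0" "a \<noteq> \<infinity>" for x y a :: ennreal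
    using that
    by (cases "y = 0"; cases x y a rule: ennreal3_cases)
       (auto simp: divide_ennreal ennreal_top_divide ennreal_divide_top)
  with assms(3,4)
  show "emeasure (uniform_measure (uniform_measure M A) B) D = emeasure (uniform_measure M (A \<inter> B)) D"
    by (simp add: Int_assoc)
qed simp

text \<open>Change of variables including integrability. As an equivalence it carries an expectation
  from \<open>X\<close> to the common law and from there back to \<open>Y\<close>.\<close>

lemma has_bochner_integral_distr_iff:
  fixes f :: "'a \<Rightarrow> 'b::{banach, second_countable_topology}"
  assumes [measurable]: "g \<in> measurable M N" "f \<in> borel_measurable N"
  shows "has_bochner_integral (distr M N g) f v \<longleftrightarrow> has_bochner_integral M (\<lambda>x. f (g x)) v"
  by (simp add: has_bochner_integral_iff integrable_distr_eq integral_distr)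

lemma vec_nth_borel_measurable [measurable]:
  "(\<lambda>x. x $ i) \<in> borel_measurable (borel :: (real ^ 'n) measure)"
  by (intro borel_measurable_continuous_onI continuous_intros)

lemma bounded_linear_vsnd: "bounded_linear (vsnd :: real ^ ('q::finite + 'p::finite) \<Rightarrow> real ^ 'p)"
  by (rule linear_conv_bounded_linear[THEN iffD1], rule linearI) (auto simp: vsnd_def vec_eq_iff)

lemma bounded_linear_vfst: "bounded_linear (vfst :: real ^ ('q::finite + 'p::finite) \<Rightarrow> real ^ 'q)"
  by (rule linear_conv_bounded_linear[THEN iffD1], rule linearI) (auto simp: vfst_def vec_eq_iff)

text \<open>The map takes the lower right block of a matrix; linearity lets it pass through the
  expectation that defines \<open>M\<close>.\<close>

lemma bounded_linear_block22:
  "bounded_linear (\<lambda>A :: real ^ ('q::finite + 'p::finite) ^ ('q + 'p). vsnd (\<chi> k. vsnd (A $ k)) :: real ^ 'p ^ 'p)"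
  by (rule linear_conv_bounded_linear[THEN iffD1], rule linearI) (auto simp: vsnd_def vec_eq_iff)

lemmas borel_measurable_vfst [measurable] =
  borel_measurable_continuous_onI[OF bounded_linear.continuous_on[OF bounded_linear_vfst continuous_on_id]]

lemmas borel_measurable_vsnd [measurable] =
  borel_measurable_continuous_onI[OF bounded_linear.continuous_on[OF bounded_linear_vsnd continuous_on_id]]

lemma borel_measurable_outer [measurable]: "outer \<in> borel_measurable borel"
  unfolding outer_def
  by (intro borel_measurable_continuous_onI continuous_intros)

lemma sets_trunc_box [measurable]: "trunc_box a b \<in> sets borel"
proof -
  have "{x \<in> space borel. \<forall>i. a $ i \<le> ereal (x $ i) \<and> ereal (x $ i) \<le> b $ i} \<in> sets borel"
    by measurable
  then show ?thesis
    by (simp add: trunc_box_def)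
qed

text \<open>The inequalities are componentwise, so they split into those at \<open>Inl\<close> and
  those at \<open>Inr\<close> indices.\<close>

lemma trunc_box_vstack:
  "x \<in> trunc_box (vstack c a) (vstack d b) \<longleftrightarrow> vfst x \<in> trunc_box c d \<and> vsnd x \<in> trunc_box a b"
  by (auto simp: trunc_box_def vstack_def vfst_def vsnd_def split: sum.split)

text \<open>
  Conditioning first on \<open>X1 \<in> C\<close>, then pushing forward to the second block and conditioning on
  a box there is the same as conditioning once on the stacked box and then pushing forward.
\<close>

lemma SLCT_EC_truncated:
  fixes X :: "'s \<Rightarrow> real ^ ('q::finite + 'p::finite)" and Y :: "'t \<Rightarrow> real ^ 'p"
  assumes "prob_space S" and X: "elliptical S X \<xi> \<Omega> h"
    and pos: "measure S {\<omega> \<in> space S. vfst (X \<omega>) \<in> trunc_box c d} > 0"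
    and Y [measurable]: "Y \<in> borel_measurable T"
    and law: "distr T borel Y = SLCT_EC \<xi> \<Omega> h (trunc_box c d)"
  shows "distr (uniform_measure T {\<omega> \<in> space T. Y \<omega> \<in> trunc_box a b}) borel Y =
    distr (uniform_measure S {\<omega> \<in> space S. X \<omega> \<in> trunc_box (vstack c a) (vstack d b)})
      borel (\<lambda>\<omega>. vsnd (X \<omega>))"
proof -
  interpret prob_space S by fact
  define L where "L = density lborel (\<lambda>x. ennreal (EC_density \<xi> \<Omega> h x))"
  have [measurable]: "X \<in> borel_measurable S" and L_lborel: "distr S lborel X = L"
    using X by (auto simp: elliptical_def distributed_def L_def)
  \<comment> \<open>\<open>distributed\<close> pushes forward to \<open>lborel\<close>, but an image
    measure depends on its target only through the sigma-algebra, which is that of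
    \<open>borel\<close>.\<close>
  have L: "L = distr S borel X"
    unfolding L_lborel[symmetric] by (rule distr_cong) simp_all
  have [measurable_cong]: "sets L = sets borel"
    by (simp add: L)
  have space_L: "space L = UNIV"
    by (simp add: L)
  have [measurable]: "{x. vfst x \<in> trunc_box c d} \<in> sets L" "{x. vsnd x \<in> trunc_box a b} \<in> sets L"
  proof -
    have "{x \<in> space L. vfst x \<in> trunc_box c d} \<in> sets L" "{x \<in> space L. vsnd x \<in> trunc_box a b} \<in> sets L"
      by measurable
    then show "{x. vfst x \<in> trunc_box c d} \<in> sets L" "{x. vsnd x \<in> trunc_box a b} \<in> sets L"
      by (simp_all add: space_L)
  qed
  have "emeasure L {x. vfst x \<in> trunc_box c d} = emeasure S {\<omega> \<in> space S. vfst (X \<omega>) \<in> trunc_box c d}"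
    unfolding L by (subst emeasure_distr) (auto simp: L[symmetric] intro!: arg_cong[where f="emeasure S"])
  \<comment> \<open>This is where the positive probability of selection enters: it makes the first
    of the two conditionings nondegenerate.\<close>
  then have L_pos: "emeasure L {x. vfst x \<in> trunc_box c d} \<noteq> 0"
      "emeasure L {x. vfst x \<in> trunc_box c d} \<noteq> \<infinity>"
    using pos by (auto simp: emeasure_eq_measure)
  have "distr (uniform_measure T {\<omega> \<in> space T. Y \<omega> \<in> trunc_box a b}) borel Y =
      uniform_measure (SLCT_EC \<xi> \<Omega> h (trunc_box c d)) (trunc_box a b)"
    by (simp add: uniform_measure_distr flip: law)
  \<comment> \<open>Pulling the truncation of \<open>Y\<close> back along \<open>vsnd\<close> leaves
    two successive conditionings of the full law \<open>L\<close>.\<close>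
  also have "\<dots> = distr (uniform_measure (uniform_measure L {x. vfst x \<in> trunc_box c d})
      {x. vsnd x \<in> trunc_box a b}) borel vsnd"
    unfolding SLCT_EC_def L_def[symmetric] by (subst uniform_measure_distr) (auto simp: space_L)
  also have "\<dots> = distr (uniform_measure L
      ({x. vfst x \<in> trunc_box c d} \<inter> {x. vsnd x \<in> trunc_box a b})) borel vsnd"
    using L_pos by (subst uniform_measure_uniform_measure) auto
  also have "{x. vfst x \<in> trunc_box c d} \<inter> {x. vsnd x \<in> trunc_box a b} =
      trunc_box (vstack c a) (vstack d b)"
    by (auto simp: trunc_box_vstack)
  also have "uniform_measure L (trunc_box (vstack c a) (vstack d b)) = distr (uniform_measure S
      {\<omega> \<in> space S. X \<omega> \<in> trunc_box (vstack c a) (vstack d b)}) borel X"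
    unfolding L by (rule uniform_measure_distr) measurable
  also have "distr \<dots> borel vsnd = distr (uniform_measure S
      {\<omega> \<in> space S. X \<omega> \<in> trunc_box (vstack c a) (vstack d b)}) borel (\<lambda>\<omega>. vsnd (X \<omega>))"
    by (subst distr_distr) (simp_all add: comp_def)
  finally show ?thesis .
qed

theorem corollary1:
  fixes S :: "'s measure" and T :: "'t measure"
    and X :: "'s \<Rightarrow> real ^ ('q::finite + 'p::finite)"
    and X1 :: "'s \<Rightarrow> real ^ 'q" and X2 :: "'s \<Rightarrow> real ^ 'p"
    and Y :: "'t \<Rightarrow> real ^ 'p"
    and \<xi> :: "real ^ ('q + 'p)" and \<Omega> :: "real ^ ('q + 'p) ^ ('q + 'p)"
    and h :: "real \<Rightarrow> real"
    and c d :: "ereal ^ 'q" and a b :: "ereal ^ 'p"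
    and \<alpha> \<beta> :: "ereal ^ ('q + 'p)"
    and m :: "real ^ ('q + 'p)" and m1 :: "real ^ 'q" and m2 :: "real ^ 'p"
    and M :: "real ^ ('q + 'p) ^ ('q + 'p)"
    and M11 :: "real ^ 'q ^ 'q" and M12 :: "real ^ 'p ^ 'q"
    and M21 :: "real ^ 'q ^ 'p" and M22 :: "real ^ 'p ^ 'p"
  assumes "prob_space S" and "prob_space T"
    and "\<And>\<omega>. X \<omega> = vstack (X1 \<omega>) (X2 \<omega>)"
    and "elliptical S X \<xi> \<Omega> h"
    and "measure S {\<omega> \<in> space S. X1 \<omega> \<in> trunc_box c d} > 0"
    and "Y \<in> borel_measurable T"
    and "distr T borel Y = SLCT_EC \<xi> \<Omega> h (trunc_box c d)"
    and "\<alpha> = vstack c a" and "\<beta> = vstack d b"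
    and "measure S {\<omega> \<in> space S. X \<omega> \<in> trunc_box \<alpha> \<beta>} > 0"
    and "measure T {\<omega> \<in> space T. Y \<omega> \<in> trunc_box a b} > 0"
    and "has_cond_expectation S X {\<omega> \<in> space S. X \<omega> \<in> trunc_box \<alpha> \<beta>} m"
    and "has_cond_expectation S (\<lambda>\<omega>. outer (X \<omega>)) {\<omega> \<in> space S. X \<omega> \<in> trunc_box \<alpha> \<beta>} M"
    and "m = vstack m1 m2"
    and "M = block_matrix M11 M12 M21 M22"
  shows "has_cond_expectation T Y {\<omega> \<in> space T. Y \<omega> \<in> trunc_box a b} m2
       \<and> has_cond_expectation T (\<lambda>\<omega>. outer (Y \<omega>)) {\<omega> \<in> space T. Y \<omega> \<in> trunc_box a b} M22"
proof -
  have vfst_X: "vfst (X \<omega>) = X1 \<omega>" for \<omega>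
    by (simp add: assms(3) vfst_def vstack_def)
  have X [measurable]: "X \<in> borel_measurable S"
    using assms(4) by (simp add: elliptical_def distributed_def)
  note [measurable] = assms(6)
  let ?S = "uniform_measure S {\<omega> \<in> space S. X \<omega> \<in> trunc_box \<alpha> \<beta>}"
  let ?T = "uniform_measure T {\<omega> \<in> space T. Y \<omega> \<in> trunc_box a b}"
  have law: "distr ?T borel Y = distr ?S borel (\<lambda>\<omega>. vsnd (X \<omega>))"
    unfolding assms(8,9) using assms(1,2,4-7) by (intro SLCT_EC_truncated) (auto simp: vfst_X)
  \<comment> \<open>The codomain of \<open>g\<close> is kept general so that one argument serves the
    mean (\<open>g\<close> the identity) and the second moment (\<open>g\<close> the outer
    product).\<close>
  have transfer: "has_bochner_integral ?T (\<lambda>\<omega>. g (Y \<omega>)) v"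
    if "has_bochner_integral ?S (\<lambda>\<omega>. g (vsnd (X \<omega>))) v" and [measurable]: "g \<in> borel_measurable borel"
    for g :: "real ^ 'p \<Rightarrow> 'b::{banach, second_countable_topology}" and v
  proof -
    have "has_bochner_integral (distr ?T borel Y) g v"
      unfolding law using that(1) by (subst has_bochner_integral_distr_iff) simp_all
    then show ?thesis
      by (subst (asm) has_bochner_integral_distr_iff) simp_all
  qed
  have "vsnd m = m2"
    by (simp add: assms(14) vsnd_def vstack_def)
  with assms(12) have "has_bochner_integral ?S (\<lambda>\<omega>. vsnd (X \<omega>)) m2"
    unfolding has_cond_expectation_def
    using has_bochner_integral_bounded_linear[OF bounded_linear_vsnd] by metis
  then have 1: "has_bochner_integral ?T Y m2"
    using transfer[of "\<lambda>y. y"] by simp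
  have "vsnd (\<chi> k. vsnd (M $ k)) = M22"
    by (simp add: assms(15) vsnd_def vstack_def block_matrix_def)
  \<comment> \<open>The lower right block of \<open>outer x\<close> involves only the second block
    of \<open>x\<close>.\<close>
  moreover have "vsnd (\<chi> k. vsnd (outer x $ k)) = outer (vsnd x)" for x :: "real ^ ('q + 'p)"
    by (simp add: vsnd_def outer_def)
  ultimately have "has_bochner_integral ?S (\<lambda>\<omega>. outer (vsnd (X \<omega>))) M22"
    using has_bochner_integral_bounded_linear[OF bounded_linear_block22 assms(13)[unfolded has_cond_expectation_def]]
    by simp
  then have 2: "has_bochner_integral ?T (\<lambda>\<omega>. outer (Y \<omega>)) M22"
    by (rule transfer) simp
  from 1 2 show ?thesis
    by (simp add: has_cond_expectation_def)
qed

end
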